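(* Let $v=2n+1$ be an odd positive integer, let $F$ be a near $1$-factor of the complete graph $K_v$, and let $L=\ell(F)$ be its list of edge-lengths. Then for every positive divisor $d$ of $v$, the number of multiples of $d$ appearing in $L$ (counted with multiplicity) does not exceed $\frac{v-d}{2}$.
   Context: $K_v$ denotes the complete graph on the vertex set $\{0,1,\dots,v-1\}$. The length of an edge $[x,y]$ of $K_v$ is $\ell(x,y)=\min(|x-y|,\,v-|x-y|)$. For a subgraph $\Gamma$ of $K_v$, $\ell(\Gamma)$ is the multiset (list) of the lengths of all edges of $\Gamma$, taken with multiplicity. A near $1$-factor of $K_{2n+1}$ is a subgraph consisting of $n$ pairwise disjoint edges and one isolated vertex. "List" means multiset. *)

theory Defs
  imports Complex_Main "HOL-Library.Multiset"
begin

text \<open>A graph is a pair of a vertex set and a set of edges, an edge being a two-element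
  set of vertices.\<close>

type_synonym graph = "nat set \<times> nat set set"

abbreviation verts :: "graph \<Rightarrow> nat set" where "verts G \<equiv> fst G"

abbreviation edges :: "graph \<Rightarrow> nat set set" where "edges G \<equiv> snd G"

definition is_graph :: "graph \<Rightarrow> bool" where
  "is_graph G \<longleftrightarrow> (\<forall>e\<in>edges G. e \<subseteq> verts G \<and> card e = 2)"

definition complete_graph :: "nat \<Rightarrow> graph" where
  "complete_graph v = ({0..<v}, {e. e \<subseteq> {0..<v} \<and> card e = 2})"

definition subgraph :: "graph \<Rightarrow> graph \<Rightarrow> bool" where
  "subgraph H G \<longleftrightarrow> is_graph H \<and> verts H \<subseteq> verts G \<and> edges H \<subseteq> edges G"

text \<open>For \<open>x, y < v\<close> the difference is below \<open>v\<close>, so the subtraction on \<open>nat\<close> is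
  not truncated.\<close>

definition vertex_length :: "nat \<Rightarrow> nat \<Rightarrow> nat \<Rightarrow> nat" where
  "vertex_length v x y =
     (let k = nat \<bar>int x - int y\<bar> in min k (v - k))"

text \<open>The length of the unordered pair \<open>{x, y}\<close>; well defined by symmetry.\<close>

definition edge_length :: "nat \<Rightarrow> nat set \<Rightarrow> nat" where
  "edge_length v e = (THE l. \<exists>x y. e = {x, y} \<and> l = vertex_length v x y)"

lemma vertex_length_commute: "vertex_length v x y = vertex_length v y x"
  by (simp add: vertex_length_def abs_minus_commute)

lemma edge_length_pair [simp]: "edge_length v {x, y} = vertex_length v x y"
  unfolding edge_length_def
  by (rule the_equality) (auto simp: doubleton_eq_iff vertex_length_commute)

definition length_list :: "nat \<Rightarrow> graph \<Rightarrow> nat multiset" where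
  "length_list v G = image_mset (edge_length v) (mset_set (edges G))"

lemma finite_edges_subgraph_complete:
  assumes "subgraph G (complete_graph v)"
  shows "finite (edges G)"
proof -
  have "edges G \<subseteq> Pow {0..<v}"
    using assms by (auto simp: subgraph_def complete_graph_def)
  then show ?thesis
    by (rule finite_subset) simp
qed

definition near_one_factor :: "nat \<Rightarrow> graph \<Rightarrow> bool" where
  "near_one_factor n F \<longleftrightarrow>
     subgraph F (complete_graph (2 * n + 1)) \<and>
     card (edges F) = n \<and>
     pairwise disjnt (edges F) \<and>
     (\<exists>!x. x \<in> verts F \<and> (\<forall>e\<in>edges F. x \<notin> e))"

end

theory Submission
  imports Defs
begin

text \<open>As \<open>d\<close> divides \<open>v\<close>, an edge has length divisible by \<open>d\<close> exactly when both its ends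
  lie in the same residue class modulo \<open>d\<close>. Each of the \<open>d\<close> classes has \<open>v / d\<close> vertices,
  an odd number, so it contains at most \<open>(v / d - 1) / 2\<close> pairwise disjoint edges.\<close>

text \<open>The length is \<open>k\<close> or \<open>v - k\<close>, where \<open>k\<close> is the
  distance between \<open>x\<close> and \<open>y\<close> as integers. These sum to \<open>v\<close>,
  a multiple of \<open>d\<close>, so \<open>d\<close> divides both or neither.\<close>

lemma dvd_vertex_length_iff:
  assumes "x < v" "y < v" "d dvd v"
  shows "d dvd vertex_length v x y \<longleftrightarrow> x mod d = y mod d"
proof -
  define k where "k = nat \<bar>int x - int y\<bar>"
  have "k \<le> v"
    using assms by (auto simp: k_def)
  then have "d dvd v - k \<longleftrightarrow> d dvd k"
    using assms(3) by (auto simp: dvd_diff_nat dest: dvd_diffD dvd_diffD1)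
  then have "d dvd vertex_length v x y \<longleftrightarrow> d dvd k"
    by (auto simp: vertex_length_def k_def[symmetric] min_def Let_def)
  also have "\<dots> \<longleftrightarrow> int d dvd int x - int y"
    by (simp add: k_def flip: int_dvd_int_iff)
  also have "\<dots> \<longleftrightarrow> x mod d = y mod d"
    by (simp flip: mod_eq_dvd_iff of_nat_mod)
  finally show ?thesis .
qed

lemma card_residue_class:
  fixes d q r :: nat
  assumes "r < d"
  shows "card {x. x < d * q \<and> x mod d = r} = q"
proof -
  have "{x. x < d * q \<and> x mod d = r} = (\<lambda>k. d * k + r) ` {..<q}"
  proof (intro equalityI subsetI)
    fix x assume "x \<in> {x. x < d * q \<and> x mod d = r}"
    then have "x = d * (x div d) + r" "x div d < q"
      using assms by (auto simp: less_mult_imp_div_less mult.commute)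
    then show "x \<in> (\<lambda>k. d * k + r) ` {..<q}" by blast
  next
    fix x assume "x \<in> (\<lambda>k. d * k + r) ` {..<q}"
    then obtain k where k: "k < q" "x = d * k + r" by blast
    have "d * k + r < d * Suc k" using assms by simp
    also have "\<dots> \<le> d * q" using k(1) by (intro mult_le_mono2) simp
    finally show "x \<in> {x. x < d * q \<and> x mod d = r}"
      using assms k by simp
  qed
  moreover have "inj_on (\<lambda>k. d * k + r) {..<q}"
    using assms by (auto intro: inj_onI)
  ultimately show ?thesis by (simp add: card_image)
qed

text \<open>Disjoint pairs share no elements, so their union uses up exactly
  \<open>2 * card M\<close> elements of \<open>C\<close>.\<close>

lemma card_disjoint_pairs_le:
  assumes "pairwise disjnt M" "\<And>e. e \<in> M \<Longrightarrow> card e = 2 \<and> e \<subseteq> C" "finite C"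
  shows "2 * card M \<le> card C"
proof -
  have "card (\<Union>M) = (\<Sum>e\<in>M. card e)"
    using assms by (intro card_Union_disjoint) (auto intro: finite_subset)
  also have "\<dots> = 2 * card M"
    using assms(2) by simp
  finally show ?thesis
    using card_mono[OF assms(3), of "\<Union>M"] assms(2) by fastforce
qed

theorem proposition1:
  fixes v n d :: nat and F :: graph and L :: "nat multiset"
  assumes "v = 2 * n + 1"
    and "near_one_factor n F"
    and "L = length_list v F"
    and "d > 0" and "d dvd v"
  shows "real (size (filter_mset (\<lambda>l. d dvd l) L)) \<le> (real v - real d) / 2"
proof -
  obtain q where q: "v = d * q" using assms(5) by blast
  have "odd v" using assms(1) by simp
  then have "odd q" by (simp add: q)
  have sub: "subgraph F (complete_graph v)" and dis: "pairwise disjnt (edges F)"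
    using assms(1,2) by (auto simp: near_one_factor_def)
  have fin: "finite (edges F)"
    using finite_edges_subgraph_complete[OF sub] .
  have edge: "e \<subseteq> {0..<v}" "card e = 2" if "e \<in> edges F" for e
    using sub that by (auto simp: subgraph_def complete_graph_def)
  define M where "M = {e \<in> edges F. d dvd edge_length v e}"
  define C where "C r = {x. x < d * q \<and> x mod d = r}" for r
  have cls: "2 * card {e \<in> M. e \<subseteq> C r} \<le> q - 1" if "r < d" for r
  proof -
    have "2 * card {e \<in> M. e \<subseteq> C r} \<le> card (C r)"
    proof (rule card_disjoint_pairs_le)
      show "pairwise disjnt {e \<in> M. e \<subseteq> C r}"
        by (rule pairwise_subset[OF dis]) (auto simp: M_def)
    qed (auto simp: M_def C_def edge(2))
    also have "\<dots> = q"
      unfolding C_def using that by (rule card_residue_class)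
    \<comment> \<open>Parity gains the extra one: an even number that is at most the odd number
      \<open>q\<close> is at most \<open>q - 1\<close>.\<close>
    finally show ?thesis
      using \<open>odd q\<close> by (auto elim!: oddE)
  qed
  \<comment> \<open>Both ends of an edge in \<open>M\<close> have the same residue, so the class of
    either end contains the whole edge.\<close>
  have "M = (\<Union>r<d. {e \<in> M. e \<subseteq> C r})"
  proof (intro equalityI subsetI)
    fix e assume e: "e \<in> M"
    then have eF: "e \<in> edges F" "d dvd edge_length v e" by (auto simp: M_def)
    then obtain x y where xy: "e = {x, y}" using edge(2) by (meson card_2_iff)
    then have "x < v" "y < v" using edge(1)[OF eF(1)] by auto
    with eF(2) xy have "x mod d = y mod d"
      by (simp add: dvd_vertex_length_iff[OF _ _ assms(5)])
    then have "e \<subseteq> C (x mod d)"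
      using xy \<open>x < v\<close> \<open>y < v\<close> by (auto simp: C_def q)
    then show "e \<in> (\<Union>r<d. {e \<in> M. e \<subseteq> C r})"
      using e assms(4) by auto
  qed auto
  then have "card M \<le> (\<Sum>r<d. card {e \<in> M. e \<subseteq> C r})"
    using card_UN_le[of "{..<d}" "\<lambda>r. {e \<in> M. e \<subseteq> C r}"] by simp
  then have "2 * card M \<le> (\<Sum>r<d. 2 * card {e \<in> M. e \<subseteq> C r})"
    by (simp flip: sum_distrib_left)
  also have "\<dots> \<le> d * (q - 1)"
    using sum_bounded_above[of "{..<d}" "\<lambda>r. 2 * card {e \<in> M. e \<subseteq> C r}" "q - 1"] cls
    by simp
  \<comment> \<open>Since \<open>q\<close> is odd, \<open>q \<ge> 1\<close>, so \<open>q - 1\<close>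
    is not truncated and \<open>d * (q - 1) + d = v\<close>. With \<open>d\<close> on the left, the
    bound passes to the reals without a subtraction on \<open>nat\<close>.\<close>
  finally have "2 * card M + d \<le> v"
    using \<open>odd q\<close> q by (auto elim!: oddE)
  then have "2 * real (card M) + real d \<le> real v"
    by linarith
  \<comment> \<open>Filtering the image multiset amounts to filtering the edges, so equal lengths of
    different edges are counted separately. Finiteness matters because \<open>mset_set\<close> of an
    infinite set is empty.\<close>
  moreover have "size (filter_mset (\<lambda>l. d dvd l) L) = card M"
    using fin by (simp add: assms(3) length_list_def M_def filter_mset_image_mset)
  ultimately show ?thesis by simp
qed

end
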